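(* Let $n\geq 7$ and $2\leq l\leq\lfloor\frac{n-3}{2}\rfloor$ be integers. If $m=\binom{n}{2}-l$, then there is no uniformly most reliable three-terminal graph in $\mathcal{G}_{n,m}$.
   Context: A three-terminal graph is a graph with three specified distinct vertices $r,s,t$, called target vertices. $\mathcal{G}_{n,m}$ denotes the set of all simple three-terminal graphs with $n$ vertices and $m$ edges. For $G\in\mathcal{G}_{n,m}$ and $p\in[0,1]$, the three-terminal reliability $R_3(G;p)$ is the probability that $r,s,t$ all lie in one connected component of the random spanning subgraph of $G$ in which each edge survives independently with probability $p$. Equivalently, $R_3(G;p)=\sum_{i=2}^{m}N_i(G)p^i(1-p)^{m-i}$, where $N_i(G)$ is the number of $i$-element subsets of $E(G)$ such that $r,s,t$ are all connected to each other using only those edges. A graph $G\in\mathcal{G}_{n,m}$ is a uniformly most reliable (three-terminal) graph in $\mathcal{G}_{n,m}$ if $R_3(G;p)\geq R_3(H;p)$ for all $H\in\mathcal{G}_{n,m}$ and all $0\leq p\leq 1$. *)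

theory Defs
  imports "HOL-Probability.Probability"
begin

text \<open>Edges are two-element sets of vertices, so loops and parallel edges cannot occur.\<close>

record 'a three_terminal_graph =
  verts :: "'a set"
  edges :: "'a set set"
  term_r :: 'a
  term_s :: 'a
  term_t :: 'a

definition simple_three_terminal_graph :: "'a three_terminal_graph \<Rightarrow> bool" where
  "simple_three_terminal_graph G \<longleftrightarrow>
     finite (verts G) \<and>
     (\<forall>e\<in>edges G. e \<subseteq> verts G \<and> card e = 2) \<and>
     {term_r G, term_s G, term_t G} \<subseteq> verts G \<and>
     term_r G \<noteq> term_s G \<and> term_r G \<noteq> term_t G \<and> term_s G \<noteq> term_t G"

definition three_terminal_graphs :: "nat \<Rightarrow> nat \<Rightarrow> 'a three_terminal_graph set" where
  "three_terminal_graphs n m =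
     {G. simple_three_terminal_graph G \<and> card (verts G) = n \<and> card (edges G) = m}"

definition connectivity :: "'a set \<Rightarrow> 'a set set \<Rightarrow> 'a rel" where
  "connectivity V F = {(u, v) \<in> V \<times> V. (u, v) \<in> {(x, y). {x, y} \<in> F}\<^sup>*}"

definition connected_components :: "'a set \<Rightarrow> 'a set set \<Rightarrow> 'a set set" where
  "connected_components V F = V // connectivity V F"

definition terminals_connected :: "'a three_terminal_graph \<Rightarrow> 'a set set \<Rightarrow> bool" where
  "terminals_connected G F \<longleftrightarrow>
     (\<exists>C\<in>connected_components (verts G) F. {term_r G, term_s G, term_t G} \<subseteq> C)"

definition surviving_edges :: "'a three_terminal_graph \<Rightarrow> real \<Rightarrow> 'a set set pmf" where
  "surviving_edges G p =
     map_pmf (\<lambda>f. {e \<in> edges G. f e}) (Pi_pmf (edges G) False (\<lambda>_. bernoulli_pmf p))"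

definition reliability3 :: "'a three_terminal_graph \<Rightarrow> real \<Rightarrow> real" where
  "reliability3 G p = measure_pmf.prob (surviving_edges G p) {F. terminals_connected G F}"

definition uniformly_most_reliable ::
    "nat \<Rightarrow> nat \<Rightarrow> 'a three_terminal_graph \<Rightarrow> bool" where
  "uniformly_most_reliable n m G \<longleftrightarrow>
     G \<in> three_terminal_graphs n m \<and>
     (\<forall>H\<in>(three_terminal_graphs n m :: 'a three_terminal_graph set). \<forall>p\<in>{0..1}. reliability3 H p \<le> reliability3 G p)"

text \<open>The probabilistic definition agrees with the reliability polynomial.\<close>

definition connecting_count :: "'a three_terminal_graph \<Rightarrow> nat \<Rightarrow> nat" where
  "connecting_count G i = card {F. F \<subseteq> edges G \<and> card F = i \<and> terminals_connected G F}"

lemma finite_edges: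
  assumes "simple_three_terminal_graph G"
  shows "finite (edges G)"
proof (rule finite_subset)
  show "edges G \<subseteq> Pow (verts G)"
    using assms by (auto simp: simple_three_terminal_graph_def)
  show "finite (Pow (verts G))"
    using assms by (simp add: simple_three_terminal_graph_def)
qed

lemma pmf_surviving_edges:
  assumes fin: "finite (edges G)" and p: "p \<in> {0..1}" and F: "F \<subseteq> edges G"
  shows "pmf (surviving_edges G p) F = p ^ card F * (1 - p) ^ (card (edges G) - card F)"
proof -
  let ?P = "Pi_pmf (edges G) False (\<lambda>_. bernoulli_pmf p)"
  have "pmf (surviving_edges G p) F
      = measure_pmf.prob ?P ((\<lambda>f. {e \<in> edges G. f e}) -` {F})"
    unfolding surviving_edges_def by (rule pmf_map)
  also have "\<dots> = measure_pmf.prob ?P {\<lambda>e. e \<in> F}"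
  proof (rule measure_prob_cong_0)
    fix f assume f: "f \<in> (\<lambda>f. {e \<in> edges G. f e}) -` {F} - {\<lambda>e. e \<in> F}"
    then obtain e where "e \<notin> edges G" "f e"
      using F by auto
    then show "pmf ?P f = 0"
      using fin by (intro pmf_Pi_outside) auto
  qed (use F in auto)
  also have "\<dots> = (\<Prod>e\<in>edges G. pmf (bernoulli_pmf p) (e \<in> F))"
    using F fin by (subst measure_pmf_single, subst pmf_Pi') auto
  also have "\<dots> = (\<Prod>e\<in>edges G. if e \<in> F then p else 1 - p)"
    using p by (intro prod.cong) auto
  also have "\<dots> = p ^ card F * (1 - p) ^ card (edges G - F)"
    using fin F by (simp add: prod.If_cases Int_absorb1 Diff_eq)
  finally show ?thesis
    using F fin by (simp add: card_Diff_subset finite_subset)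
qed

lemma terminals_connected_card:
  assumes G: "simple_three_terminal_graph G" and F: "F \<subseteq> edges G" and con: "terminals_connected G F"
  shows "2 \<le> card F"
proof -
  let ?A = "{(x, y). {x, y} \<in> F}"
  obtain w where w: "\<forall>x\<in>{term_r G, term_s G, term_t G}. (w, x) \<in> ?A\<^sup>*"
    using con unfolding terminals_connected_def connected_components_def connectivity_def
    by (auto elim!: quotientE)
  have edge: "\<exists>e\<in>F. x \<in> e" if "(w, x) \<in> ?A\<^sup>*" "x \<noteq> w" for x
    using that by (cases rule: rtranclE) auto
  have first: "\<exists>e\<in>F. w \<in> e" if "(w, x) \<in> ?A\<^sup>*" "x \<noteq> w" for x
    using that by (cases rule: converse_rtranclE) auto
  have cov: "\<forall>x\<in>{term_r G, term_s G, term_t G}. \<exists>e\<in>F. x \<in> e"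
    using G w edge first unfolding simple_three_terminal_graph_def
    by (metis insertCI)
  have fin: "finite F"
    using F finite_edges[OF G] finite_subset by blast
  show ?thesis
  proof (rule ccontr)
    assume "\<not> 2 \<le> card F"
    then have "card F \<le> Suc 0" by simp
    then obtain e where e: "e \<in> F" "{term_r G, term_s G, term_t G} \<subseteq> e"
      using cov fin by (metis card_le_Suc0_iff_eq insertCI insert_subset empty_subsetI)
    have "card e = 2" using e F G unfolding simple_three_terminal_graph_def by blast
    moreover have "card {term_r G, term_s G, term_t G} = 3"
      using G by (simp add: simple_three_terminal_graph_def)
    moreover have "finite e" using \<open>card e = 2\<close> card.infinite by fastforce
    ultimately show False
      using card_mono[OF \<open>finite e\<close> e(2)] by simp
  qed
qed

lemma reliability3_polynomial:
  assumes G: "G \<in> three_terminal_graphs n m" and p: "p \<in> {0..1}"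
  shows "reliability3 G p = (\<Sum>i=2..m. real (connecting_count G i) * p ^ i * (1 - p) ^ (m - i))"
proof -
  have simp_G: "simple_three_terminal_graph G" and m: "card (edges G) = m"
    using G by (auto simp: three_terminal_graphs_def)
  note fin = finite_edges[OF simp_G]
  let ?S = "{F. F \<subseteq> edges G \<and> terminals_connected G F}"
  have finS: "finite ?S" using fin by simp
  have "reliability3 G p = measure_pmf.prob (surviving_edges G p) ?S"
    unfolding reliability3_def
    by (rule measure_prob_cong_0) (auto simp: surviving_edges_def pmf_eq_0_set_pmf)
  also have "\<dots> = (\<Sum>F\<in>?S. pmf (surviving_edges G p) F)"
    using finS by (rule measure_measure_pmf_finite)
  also have "\<dots> = (\<Sum>F\<in>?S. p ^ card F * (1 - p) ^ (m - card F))"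
    using pmf_surviving_edges[OF fin p] m by (intro sum.cong) auto
  also have "\<dots> = (\<Sum>i=2..m. \<Sum>F\<in>{F\<in>?S. card F = i}. p ^ card F * (1 - p) ^ (m - card F))"
  proof (rule sum.group[symmetric])
    show "card ` ?S \<subseteq> {2..m}"
      using terminals_connected_card[OF simp_G] card_mono[OF fin] m by auto
  qed (use finS in auto)
  also have "\<dots> = (\<Sum>i=2..m. real (connecting_count G i) * p ^ i * (1 - p) ^ (m - i))"
  proof (rule sum.cong[OF refl])
    fix i
    have "{F\<in>?S. card F = i} = {F. F \<subseteq> edges G \<and> card F = i \<and> terminals_connected G F}"
      by auto
    then show "(\<Sum>F\<in>{F\<in>?S. card F = i}. p ^ card F * (1 - p) ^ (m - card F))
      = real (connecting_count G i) * p ^ i * (1 - p) ^ (m - i)"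
      by (simp add: connecting_count_def)
  qed
  finally show ?thesis .
qed

end

theory Submission
  imports Defs
begin

text \<open>
  The requirements for being best when almost all edges survive and when almost none do
  contradict each other. Throughout, a graph is described by the pairs that it misses; \<open>T\<close> is the
  set of the three target vertices.

  For survival probability close to 1, failure probabilities are compared by the sizes of the
  smallest failing edge sets. Since $2l \<le> n - 3$, some graph misses \<open>l\<close> disjoint pairs of
  non-target vertices; there every cut that separates targets has at least $n - 1$ edges, and
  at least $2n - 5$ if no target gets isolated (\<open>matching_complement_cut\<close>). If a
  competitor misses a pair at a target, isolating that target costs only $n - 2$ edges. If it
  misses none, but two pairs at one vertex \<open>v\<close>, then its probability of isolating a target
  is still that of the matching graph, as the edges at targets are the same; but cutting off
  \<open>v\<close> together with a target costs at most $2n - 6$ edges. Hence the missing pairs of a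
  uniformly most reliable graph form a matching on the non-target vertices
  (\<open>missing_terminal_pair_not_optimal\<close>, \<open>adjacent_missing_pairs_not_optimal\<close>).

  For survival probability close to 0 this matching is a handicap. Let \<open>ab\<close> and \<open>cd\<close>
  be two of the missing pairs, and replace the edge \<open>ac\<close> by \<open>cd\<close>. Both graphs arise from
  the same graph \<open>B\<close>, by adding \<open>bd\<close> and \<open>ac\<close>, respectively \<open>bd\<close> and
  \<open>cd\<close>. Exchanging \<open>a\<close> and \<open>d\<close> is a symmetry of \<open>B\<close>, so \<open>ac\<close> alone and
  \<open>cd\<close> alone are worth the same. Together with \<open>bd\<close>, however, the new edge forms a path
  through \<open>b\<close>, \<open>d\<close>, \<open>c\<close>, which joins the targets once the three edges
  \<open>rb\<close>, \<open>sd\<close>, \<open>tc\<close> of \<open>B\<close> survive, whereas any advantage of the disjoint edges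
  requires four surviving edges of \<open>B\<close> (\<open>adjacent_extra_edges_gain\<close>). So the new graph is
  better for small probabilities (\<open>matching_beaten_by_path\<close>). The hypothesis $l \<ge> 2$ supplies
  the two missing pairs.
\<close>

section \<open>Expectations over independent random subsets\<close>

text \<open>
  The expectation of \<open>g\<close> on a random subset of \<open>A\<close> that contains each element
  independently with probability \<open>p\<close>, written as a polynomial in \<open>p\<close>: its algebraic
  identities then need no bounds on \<open>p\<close>.
\<close>

definition bernoulli_mean :: "real \<Rightarrow> 'e set \<Rightarrow> ('e set \<Rightarrow> real) \<Rightarrow> real" where
  "bernoulli_mean p A g = (\<Sum>X\<in>Pow A. p ^ card X * (1 - p) ^ card (A - X) * g X)"

lemma bernoulli_mean_empty [simp]: "bernoulli_mean p {} g = g {}"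
  by (simp add: bernoulli_mean_def)

lemma bernoulli_mean_insert:
  assumes "finite A" "x \<notin> A"
  shows "bernoulli_mean p (insert x A) g =
    p * bernoulli_mean p A (\<lambda>X. g (insert x X)) + (1 - p) * bernoulli_mean p A g"
proof -
  let ?w = "\<lambda>X. p ^ card X * (1 - p) ^ card (insert x A - X) * g X"
  have inj: "inj_on (insert x) (Pow A)"
    using assms(2) by (force simp: inj_on_def)
  have "bernoulli_mean p (insert x A) g = sum ?w (Pow A) + sum ?w (insert x ` Pow A)"
    unfolding bernoulli_mean_def Pow_insert
    by (rule sum.union_disjoint) (use assms in auto)
  also have "sum ?w (insert x ` Pow A) = p * bernoulli_mean p A (\<lambda>X. g (insert x X))"
    unfolding bernoulli_mean_def sum.reindex[OF inj] sum_distrib_left o_def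
  proof (rule sum.cong[OF refl])
    fix X assume X: "X \<in> Pow A"
    then have "finite X" "x \<notin> X" using assms finite_subset by auto
    moreover have "insert x A - insert x X = A - X" using assms X by auto
    ultimately show "p ^ card (insert x X) * (1 - p) ^ card (insert x A - insert x X) * g (insert x X)
      = p * (p ^ card X * (1 - p) ^ card (A - X) * g (insert x X))"
      by simp
  qed
  also have "sum ?w (Pow A) = (1 - p) * bernoulli_mean p A g"
    unfolding bernoulli_mean_def sum_distrib_left
  proof (rule sum.cong[OF refl])
    fix X assume X: "X \<in> Pow A"
    then have "insert x A - X = insert x (A - X)" using assms by auto
    then show "?w X = (1 - p) * (p ^ card X * (1 - p) ^ card (A - X) * g X)"
      using assms by simp
  qed
  finally show ?thesis by simp
qed

text \<open>
  Elements on which \<open>g\<close> does not depend can be ignored: each of them contributes the factor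
  $p + (1 - p) = 1$.
\<close>

lemma bernoulli_mean_disjoint:
  assumes "finite A" "finite B" "A \<inter> B = {}"
  shows "bernoulli_mean p (A \<union> B) (\<lambda>X. g (X \<inter> A)) = bernoulli_mean p A g"
  using assms(2,3)
proof (induction B rule: finite_induct)
  case empty
  show ?case by (auto simp: bernoulli_mean_def Int_absorb2 intro!: sum.cong)
next
  case (insert x B)
  then have "x \<notin> A \<union> B" "\<And>X. insert x X \<inter> A = X \<inter> A" by auto
  with insert show ?case
    using assms(1) bernoulli_mean_insert[of "A \<union> B" x p "\<lambda>X. g (X \<inter> A)"]
    by (simp add: algebra_simps)
qed

lemma bernoulli_mean_const:
  assumes "finite A"
  shows "bernoulli_mean p A (\<lambda>_. c) = c"
  using bernoulli_mean_disjoint[of "{}" A p "\<lambda>_. c"] assms by simp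

lemma bernoulli_mean_image:
  assumes "inj_on f A"
  shows "bernoulli_mean p (f ` A) g = bernoulli_mean p A (\<lambda>X. g (f ` X))"
proof -
  have inj: "inj_on ((`) f) (Pow A)" using assms by (rule inj_on_image_Pow)
  show ?thesis
    unfolding bernoulli_mean_def image_Pow_surj[OF refl, symmetric] sum.reindex[OF inj] o_def
  proof (rule sum.cong[OF refl])
    fix X assume "X \<in> Pow A"
    then have X: "X \<subseteq> A" by simp
    have "card (f ` X) = card X"
      using X assms by (meson card_image inj_on_subset)
    moreover have "f ` A - f ` X = f ` (A - X)"
      using inj_on_image_set_diff[OF assms, of A X] X by auto
    moreover have "card (f ` (A - X)) = card (A - X)"
      using assms by (meson card_image inj_on_subset Diff_subset)
    ultimately show "p ^ card (f ` X) * (1 - p) ^ card (f ` A - f ` X) * g (f ` X)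
      = p ^ card X * (1 - p) ^ card (A - X) * g (f ` X)" by simp
  qed
qed

lemma bernoulli_mean_mono:
  assumes "0 \<le> p" "p \<le> 1" "\<And>X. X \<subseteq> A \<Longrightarrow> g X \<le> h X"
  shows "bernoulli_mean p A g \<le> bernoulli_mean p A h"
  unfolding bernoulli_mean_def by (intro sum_mono mult_left_mono) (use assms in auto)

lemma bernoulli_mean_add:
  "bernoulli_mean p A (\<lambda>X. g X + h X) = bernoulli_mean p A g + bernoulli_mean p A h"
  by (simp add: bernoulli_mean_def ring_distribs sum.distrib)

lemma bernoulli_mean_diff:
  "bernoulli_mean p A (\<lambda>X. g X - h X) = bernoulli_mean p A g - bernoulli_mean p A h"
  by (simp add: bernoulli_mean_def right_diff_distrib sum_subtractf)

lemma bernoulli_mean_of_not: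
  assumes "finite A"
  shows "bernoulli_mean p A (\<lambda>X. of_bool (\<not> P X)) = 1 - bernoulli_mean p A (\<lambda>X. of_bool (P X))"
  using bernoulli_mean_diff[of p A "\<lambda>_. 1" "\<lambda>X. of_bool (P X)"] bernoulli_mean_const[OF assms, of p 1]
  by (simp add: of_bool_not_iff)

lemma bernoulli_mean_single:
  assumes "finite A" "X \<subseteq> A"
  shows "bernoulli_mean p A (\<lambda>Y. of_bool (Y = X)) = p ^ card X * (1 - p) ^ card (A - X)"
proof -
  have "bernoulli_mean p A (\<lambda>Y. of_bool (Y = X))
      = (\<Sum>Y\<in>Pow A. if Y = X then p ^ card X * (1 - p) ^ card (A - X) else 0)"
    unfolding bernoulli_mean_def by (intro sum.cong) auto
  also have "\<dots> = p ^ card X * (1 - p) ^ card (A - X)"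
    using assms by simp
  finally show ?thesis .
qed

lemma bernoulli_mean_event_le:
  assumes "finite A" "\<And>X. X \<subseteq> A \<Longrightarrow> P X \<Longrightarrow> p ^ card X * (1 - p) ^ card (A - X) \<le> c"
    "0 \<le> c"
  shows "bernoulli_mean p A (\<lambda>X. of_bool (P X)) \<le> 2 ^ card A * c"
proof -
  have "bernoulli_mean p A (\<lambda>X. of_bool (P X)) \<le> (\<Sum>X\<in>Pow A. c)"
    unfolding bernoulli_mean_def by (intro sum_mono) (use assms in auto)
  then show ?thesis using assms(1) by (simp add: card_Pow)
qed

lemma bernoulli_mean_event_ge:
  assumes "finite A" "0 \<le> p" "p \<le> 1" "X \<subseteq> A" "P X" "card (A - X) \<le> k"
  shows "p ^ card A * (1 - p) ^ k \<le> bernoulli_mean p A (\<lambda>X. of_bool (P X))"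
proof -
  have "card X \<le> card A" using assms by (intro card_mono) auto
  then have "p ^ card A * (1 - p) ^ k \<le> p ^ card X * (1 - p) ^ card (A - X)"
    using assms by (intro mult_mono power_decreasing) auto
  also have "\<dots> = bernoulli_mean p A (\<lambda>Y. of_bool (Y = X))"
    using assms by (simp add: bernoulli_mean_single)
  also have "\<dots> \<le> bernoulli_mean p A (\<lambda>X. of_bool (P X))"
    using assms by (intro bernoulli_mean_mono) auto
  finally show ?thesis .
qed

text \<open>
  A power $p^k$ beats any multiple of $p^{k+1}$ near 0, even with a factor that tends to 1. The
  witness makes $(C + N) p < 1$, so that $C p < 1 - N p \<le> (1 - p)^N$ by Bernoulli's inequality.
\<close>

lemma exists_dominating_probability:
  fixes C :: real and k N :: nat
  assumes "0 \<le> C"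
  shows "\<exists>p. 0 < p \<and> p < 1 \<and> C * p ^ Suc k < p ^ k * (1 - p) ^ N"
proof -
  define p where "p = 1 / (C + N + 2)"
  have pos: "0 < C + N + 2" using assms by simp
  have p: "0 < p" "p < 1" using pos assms by (auto simp: p_def)
  have "(C + N) * p < 1" using pos by (simp add: p_def divide_simps)
  then have "C * p < 1 + N * (- p)" by (simp add: algebra_simps)
  also have "\<dots> \<le> (1 + - p) ^ N" using p by (intro Bernoulli_inequality) auto
  finally have "p ^ k * (C * p) < p ^ k * (1 - p) ^ N" using p by simp
  with p show ?thesis by (intro exI[of _ p]) (simp add: algebra_simps)
qed

text \<open>
  The leading term near $p = 1$: an event that occurs when some \<open>k\<close> elements are lost has
  probability of order at least $(1 - p)^k$, and one that requires the loss of $k + 1$ elements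
  has order at most $(1 - p)^{k+1}$.
\<close>

lemma smaller_failure_more_likely:
  assumes "finite A" "finite B" "card A = card B"
    and small: "X \<subseteq> A" "P X" "card (A - X) \<le> k"
    and large: "\<And>Y. Y \<subseteq> B \<Longrightarrow> Q Y \<Longrightarrow> Suc k \<le> card (B - Y)"
  shows "\<exists>p. 0 < p \<and> p < 1 \<and>
    bernoulli_mean p B (\<lambda>Y. of_bool (Q Y)) < bernoulli_mean p A (\<lambda>X. of_bool (P X))"
proof -
  obtain q :: real where q: "0 < q" "q < 1" "2 ^ card A * q ^ Suc k < q ^ k * (1 - q) ^ card A"
    using exists_dominating_probability[of "2 ^ card A" k "card A"] by (auto simp del: power_Suc)
  have "bernoulli_mean (1 - q) B (\<lambda>Y. of_bool (Q Y)) \<le> 2 ^ card B * q ^ Suc k"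
  proof (rule bernoulli_mean_event_le)
    fix Y assume "Y \<subseteq> B" "Q Y"
    then have "q ^ card (B - Y) \<le> q ^ Suc k" using large q by (intro power_decreasing) auto
    moreover have "(1 - q) ^ card Y \<le> 1" using q by (intro power_le_one) auto
    ultimately show "(1 - q) ^ card Y * (1 - (1 - q)) ^ card (B - Y) \<le> q ^ Suc k"
      using mult_mono[of "(1 - q) ^ card Y" 1 "q ^ card (B - Y)" "q ^ Suc k"] q by simp
  qed (use assms q in auto)
  also have "\<dots> < (1 - q) ^ card A * (1 - (1 - q)) ^ k"
    using q assms(3) by (simp add: mult.commute)
  also have "\<dots> \<le> bernoulli_mean (1 - q) A (\<lambda>X. of_bool (P X))"
    using assms q by (intro bernoulli_mean_event_ge) auto
  finally show ?thesis using q by (intro exI[of _ "1 - q"]) simp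
qed

section \<open>Connections through a set of edges\<close>

definition joined :: "'a set set \<Rightarrow> 'a \<Rightarrow> 'a \<Rightarrow> bool" where
  "joined F x y \<longleftrightarrow> (x, y) \<in> {(x, y). {x, y} \<in> F}\<^sup>*"

definition joins_all :: "'a set set \<Rightarrow> 'a set \<Rightarrow> bool" where
  "joins_all F T \<longleftrightarrow> (\<forall>x\<in>T. \<forall>y\<in>T. joined F x y)"

lemma joined_refl [simp]: "joined F x x"
  by (simp add: joined_def)

lemma joined_edge: "{x, y} \<in> F \<Longrightarrow> joined F x y"
  by (auto simp: joined_def)

lemma joined_trans: "joined F x y \<Longrightarrow> joined F y z \<Longrightarrow> joined F x z"
  by (auto simp: joined_def)

lemma joined_sym: "joined F x y \<Longrightarrow> joined F y x"
proof -
  have "sym {(x, y). {x, y} \<in> F}" by (auto simp: sym_def insert_commute)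
  then show "joined F x y \<Longrightarrow> joined F y x"
    unfolding joined_def using sym_rtrancl symD by metis
qed

lemma joined_mono: "F \<subseteq> F' \<Longrightarrow> joined F x y \<Longrightarrow> joined F' x y"
  unfolding joined_def by (erule rtrancl_mono[THEN subsetD, rotated]) auto

text \<open>To refute a connection, exhibit a set closed under adjacency.\<close>

lemma joined_closed:
  assumes "joined F x y" "x \<in> S" "\<And>u v. {u, v} \<in> F \<Longrightarrow> u \<in> S \<Longrightarrow> v \<in> S"
  shows "y \<in> S"
  using assms(1) unfolding joined_def
  by (induction rule: rtrancl_induct) (use assms in auto)

lemma joined_image:
  assumes "joined F x y"
  shows "joined ((`) f ` F) (f x) (f y)"
proof -
  have "y \<in> {y. joined ((`) f ` F) (f x) (f y)}"
    using assms
  proof (rule joined_closed)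
    fix u v assume uv: "{u, v} \<in> F" "u \<in> {y. joined ((`) f ` F) (f x) (f y)}"
    have "{f u, f v} = f ` {u, v}" by simp
    with uv have "joined ((`) f ` F) (f u) (f v)" by (intro joined_edge) blast
    with uv(2) show "v \<in> {y. joined ((`) f ` F) (f x) (f y)}"
      by (simp add: joined_trans[of _ "f x" "f u" "f v"])
  qed simp
  then show ?thesis by simp
qed

lemma joined_covers: "joined F x y \<Longrightarrow> x \<noteq> y \<Longrightarrow> x \<in> \<Union>F"
  unfolding joined_def by (cases rule: converse_rtranclE) auto

text \<open>
  A path between other vertices never profits from an edge \<open>ac\<close> whose end \<open>a\<close> lies on no
  further edge. The proof tracks the vertices reached from \<open>x\<close>, where \<open>a\<close> counts as reached
  as soon as \<open>c\<close> is. In place of minimal connecting trees, the estimates for rarely surviving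
  edges rest on this fact: both ends of an edge that is needed lie on further edges.
\<close>

lemma joined_pendant:
  assumes "joined (insert {a, c} F) x y" "a \<notin> \<Union>F" "x \<noteq> a" "y \<noteq> a"
  shows "joined F x y"
proof -
  have "y \<in> {z. if z = a then joined F x c else joined F x z}"
    using assms(1)
  proof (rule joined_closed)
    fix u v assume uv: "{u, v} \<in> insert {a, c} F" "u \<in> {z. if z = a then joined F x c else joined F x z}"
    show "v \<in> {z. if z = a then joined F x c else joined F x z}"
    proof (cases "{u, v} \<in> F")
      case True
      then have "u \<noteq> a" "v \<noteq> a" using assms(2) by auto
      with True uv show ?thesis using joined_edge joined_trans by fastforce
    next
      case False
      with uv show ?thesis by (auto simp: doubleton_eq_iff split: if_splits)
    qed
  qed (use assms in simp)
  then show ?thesis using assms by simp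
qed

lemma joins_all_mono: "F \<subseteq> F' \<Longrightarrow> joins_all F T \<Longrightarrow> joins_all F' T"
  unfolding joins_all_def by (meson joined_mono)

lemma joins_all_pendant:
  assumes "joins_all (insert {a, c} F) T" "a \<notin> \<Union>F" "a \<notin> T"
  shows "joins_all F T"
  unfolding joins_all_def
proof (intro ballI)
  fix x y assume "x \<in> T" "y \<in> T"
  with assms show "joined F x y"
    by (intro joined_pendant[of a c F x y]) (auto simp: joins_all_def)
qed

lemma joins_all_covers:
  assumes "joins_all F T" "x \<in> T" "y \<in> T" "x \<noteq> y"
  shows "T \<subseteq> \<Union>F"
proof
  fix z assume z: "z \<in> T"
  obtain w where "w \<in> T" "w \<noteq> z" using assms by metis
  with z assms(1) show "z \<in> \<Union>F"
    unfolding joins_all_def by (metis joined_covers)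
qed

lemma joins_all_image:
  assumes "joins_all F T" "\<And>x. x \<in> T \<Longrightarrow> f x = x"
  shows "joins_all ((`) f ` F) T"
  unfolding joins_all_def
proof (intro ballI)
  fix x y assume "x \<in> T" "y \<in> T"
  with assms joined_image[of F x y f] show "joined ((`) f ` F) x y"
    by (simp add: joins_all_def)
qed

lemma terminals_connected_iff_joins_all:
  assumes "simple_three_terminal_graph G"
  shows "terminals_connected G F \<longleftrightarrow> joins_all F {term_r G, term_s G, term_t G}"
proof
  assume "terminals_connected G F"
  then obtain w where "\<forall>x\<in>{term_r G, term_s G, term_t G}. joined F w x"
    unfolding terminals_connected_def connected_components_def connectivity_def joined_def
    by (auto elim!: quotientE)
  then show "joins_all F {term_r G, term_s G, term_t G}"
    unfolding joins_all_def by (meson joined_sym joined_trans)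
next
  assume *: "joins_all F {term_r G, term_s G, term_t G}"
  have V: "{term_r G, term_s G, term_t G} \<subseteq> verts G"
    using assms by (simp add: simple_three_terminal_graph_def)
  let ?C = "connectivity (verts G) F `` {term_r G}"
  have "?C \<in> connected_components (verts G) F"
    unfolding connected_components_def using V by (intro quotientI) auto
  moreover have "{term_r G, term_s G, term_t G} \<subseteq> ?C"
    using * V by (auto simp: joins_all_def connectivity_def joined_def)
  ultimately show "terminals_connected G F"
    unfolding terminals_connected_def by blast
qed

lemma reliability3_eq_bernoulli_mean:
  assumes G: "simple_three_terminal_graph G" and p: "p \<in> {0..1}"
  shows "reliability3 G p =
    bernoulli_mean p (edges G) (\<lambda>F. of_bool (joins_all F {term_r G, term_s G, term_t G}))"
proof -
  note fin = finite_edges[OF G]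
  let ?J = "\<lambda>F. joins_all F {term_r G, term_s G, term_t G}"
  let ?S = "{F \<in> Pow (edges G). ?J F}"
  have "reliability3 G p = measure_pmf.prob (surviving_edges G p) ?S"
    unfolding reliability3_def
    by (rule measure_prob_cong_0)
      (auto simp: surviving_edges_def pmf_eq_0_set_pmf terminals_connected_iff_joins_all[OF G])
  also have "\<dots> = (\<Sum>F\<in>?S. pmf (surviving_edges G p) F)"
    using fin by (intro measure_measure_pmf_finite) simp
  also have "\<dots> = (\<Sum>F\<in>?S. p ^ card F * (1 - p) ^ card (edges G - F))"
    using pmf_surviving_edges[OF fin p] fin
    by (intro sum.cong) (auto simp: card_Diff_subset finite_subset)
  also have "\<dots> = (\<Sum>F\<in>Pow (edges G). if ?J F then p ^ card F * (1 - p) ^ card (edges G - F) else 0)"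
    using fin by (intro sum.inter_filter) simp
  also have "\<dots> = bernoulli_mean p (edges G) (\<lambda>F. of_bool (?J F))"
    unfolding bernoulli_mean_def by (intro sum.cong) auto
  finally show ?thesis .
qed

section \<open>Pairs, matchings and cuts\<close>

definition pairs :: "'a set \<Rightarrow> 'a set set" where
  "pairs V = {e. e \<subseteq> V \<and> card e = 2}"

lemma finite_pairs: "finite V \<Longrightarrow> finite (pairs V)"
  by (rule finite_subset[of _ "Pow V"]) (auto simp: pairs_def)

lemma card_pairs: "finite V \<Longrightarrow> card (pairs V) = card V choose 2"
  unfolding pairs_def by (rule n_subsets)

lemma doubleton_in_pairs [simp]: "{x, y} \<in> pairs V \<longleftrightarrow> x \<in> V \<and> y \<in> V \<and> x \<noteq> y"
  by (auto simp: pairs_def card_2_iff' doubleton_eq_iff)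

lemma pairs_memE:
  assumes "e \<in> pairs V" "x \<in> e"
  obtains y where "e = {x, y}" "x \<noteq> y" "y \<in> V"
  using assms unfolding pairs_def card_2_iff by blast

text \<open>Every edge covers two vertices; this turns covering requirements into lower bounds on edges.\<close>

lemma card_covered_le:
  assumes "finite F" "F \<subseteq> pairs V" "C \<subseteq> \<Union>F"
  shows "card C \<le> 2 * card F"
proof -
  have c: "card e = 2" if "e \<in> F" for e
    using assms(2) that by (auto simp: pairs_def)
  then have f: "finite (\<Union>F)"
    using assms(1) by (intro finite_Union) (auto intro: card_ge_0_finite)
  have "card C \<le> card (\<Union>F)" using f assms(3) by (rule card_mono)
  also have "\<dots> \<le> (\<Sum>e\<in>F. card e)" by (rule card_Union_le_sum_card)
  also have "\<dots> = 2 * card F" using c by simp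
  finally show ?thesis .
qed

lemma disjoint_pairs_exist:
  assumes "finite W" "2 * l \<le> card W"
  shows "\<exists>M. M \<subseteq> pairs W \<and> card M = l \<and> disjoint M"
  using assms(2)
proof (induction l)
  case 0
  show ?case by (intro exI[of _ "{}"]) auto
next
  case (Suc l)
  then obtain M where M: "M \<subseteq> pairs W" "card M = l" "disjoint M" by auto
  have finM: "finite M" using M finite_pairs[OF assms(1)] finite_subset by blast
  have fU: "finite (\<Union>M)" "\<Union>M \<subseteq> W"
    using M assms(1) by (auto simp: pairs_def intro: finite_subset)
  have "card (\<Union>M) \<le> 2 * l" using card_covered_le[OF finM M(1) order_refl] M by simp
  then have "2 \<le> card (W - \<Union>M)"
    using Suc.prems fU card_Diff_subset[OF fU] by simp
  then obtain e where e: "e \<subseteq> W - \<Union>M" "card e = 2"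
    using obtain_subset_with_card_n by metis
  have "e \<notin> M"
  proof
    assume "e \<in> M"
    then have "e = {}" using e by blast
    then show False using e by simp
  qed
  have "disjoint (insert e M)" using M(3) e(1) unfolding pairwise_def disjnt_def by blast
  with M e finM \<open>e \<notin> M\<close> show ?case
    by (intro exI[of _ "insert e M"]) (auto simp: pairs_def)
qed

definition crossing :: "'a set \<Rightarrow> 'a set \<Rightarrow> 'a set set" where
  "crossing S S' = (\<lambda>(u, v). {u, v}) ` (S \<times> S')"

lemma crossing_commute: "crossing S S' = crossing S' S"
  unfolding crossing_def by (force simp: insert_commute)

lemma card_crossing:
  assumes "S \<inter> S' = {}"
  shows "card (crossing S S') = card S * card S'"
proof -
  have "inj_on (\<lambda>(u, v). {u, v}) (S \<times> S')"
    using assms by (auto simp: inj_on_def doubleton_eq_iff)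
  then show ?thesis unfolding crossing_def by (simp add: card_image card_cartesian_product)
qed

text \<open>
  Disjoint pairs that cross the cut have distinct ends in \<open>S\<close>, and the unmatched vertex \<open>x\<close> is
  none of them.
\<close>

lemma card_crossing_matching:
  assumes "disjoint M" "finite S" "x \<in> S" "x \<notin> \<Union>M"
  shows "card (M \<inter> crossing S S') \<le> card S - 1"
proof -
  have ex: "\<exists>u. u \<in> e \<inter> S" if "e \<in> M \<inter> crossing S S'" for e
    using that by (auto simp: crossing_def)
  define f where "f e = (SOME u. u \<in> e \<inter> S)" for e
  have f: "f e \<in> e \<inter> S" if "e \<in> M \<inter> crossing S S'" for e
    unfolding f_def using ex[OF that] by (rule someI_ex)
  have "inj_on f (M \<inter> crossing S S')"
  proof (rule inj_onI)
    fix e e' assume *: "e \<in> M \<inter> crossing S S'" "e' \<in> M \<inter> crossing S S'" "f e = f e'"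
    then have "e \<inter> e' \<noteq> {}" using f[of e] f[of e'] by auto
    with * assms(1) show "e = e'" unfolding pairwise_def disjnt_def by auto
  qed
  moreover have "f ` (M \<inter> crossing S S') \<subseteq> S - {x}" using f assms(4) by fastforce
  ultimately have "card (M \<inter> crossing S S') \<le> card (S - {x})"
    using assms(2) by (intro card_inj_on_le) auto
  then show ?thesis using assms by simp
qed

text \<open>
  A cut into parts of sizes \<open>j\<close> and \<open>k\<close> has \<open>j * k\<close> pairs, of which a matching that avoids a
  vertex on either side contains fewer than the smaller of \<open>j\<close> and \<open>k\<close>; the others number at
  most \<open>d\<close>. For $j \<le> k$ the excess of $jk - (j - 1)$ over $n - 1$ is $(j - 1)(k - 2)$, and the
  excess over $2n - 5$ is $(j - 2)(k - 3)$.
\<close>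

lemma cut_arith:
  fixes j k n d :: nat
  assumes "j \<ge> 1" "k \<ge> 1" "n = j + k" "j * k \<le> d + (j - 1)" "j * k \<le> d + (k - 1)"
  shows "n - 1 \<le> d"
    and "2 \<le> j \<Longrightarrow> 2 \<le> k \<Longrightarrow> 6 \<le> n \<Longrightarrow> 2 * n - 5 \<le> d"
proof -
  have main: "n - 1 \<le> d \<and> (2 \<le> j \<and> 2 \<le> k \<and> 6 \<le> n \<longrightarrow> 2 * n - 5 \<le> d)"
    if jk: "j \<le> k" "j \<ge> 1" "n = j + k" "j * k \<le> d + (j - 1)" for j k
  proof -
    obtain i where i: "j = Suc i" using jk by (cases j) auto
    obtain h where h: "k = Suc i + h" using jk i le_iff_add by metis
    have ge: "i * i + i * h + i + h + 1 \<le> d" using jk i h by (simp add: algebra_simps)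
    have ii: "i \<le> i * i" by (cases i) auto
    have n: "n = 2 * i + h + 2" using jk i h by simp
    have "n - 1 \<le> d" using ge ii n by linarith
    moreover have "2 * n - 5 \<le> d" if "2 \<le> j" "6 \<le> n"
    proof (cases "i = 1")
      case True
      then show ?thesis using ge n by simp
    next
      case False
      then have "2 \<le> i" using \<open>2 \<le> j\<close> i by simp
      then obtain k where "i = 2 + k" using le_iff_add by blast
      then have "3 * i \<le> i * i + 2" by (simp add: algebra_simps)
      moreover have "2 * h \<le> i * h" using \<open>2 \<le> i\<close> by simp
      ultimately show ?thesis using ge n by linarith
    qed
    ultimately show ?thesis by simp
  qed
  have comm: "j * k = k * j" "j + k = k + j" by auto
  have "n - 1 \<le> d \<and> (2 \<le> j \<and> 2 \<le> k \<and> 6 \<le> n \<longrightarrow> 2 * n - 5 \<le> d)"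
    using main[of j k] main[of k j] assms comm by (cases "j \<le> k") auto
  then show "n - 1 \<le> d" "2 \<le> j \<Longrightarrow> 2 \<le> k \<Longrightarrow> 6 \<le> n \<Longrightarrow> 2 * n - 5 \<le> d" by auto
qed

text \<open>
  If \<open>F\<close> fails to join \<open>T\<close>, the vertices reached from some target form one side of a cut
  without edges of \<open>F\<close> and with a target on either side. When every target still has an edge
  of \<open>F\<close>, both sides have at least two vertices, which almost doubles the bound.
\<close>

lemma matching_complement_cut:
  assumes V: "finite V" and T: "T \<subseteq> V" and M: "disjoint M" "T \<inter> \<Union>M = {}"
    and F: "F \<subseteq> pairs V - M" and split: "\<not> joins_all F T"
  shows "card V - 1 \<le> card (pairs V - M - F)"
    and "T \<subseteq> \<Union>F \<Longrightarrow> 6 \<le> card V \<Longrightarrow> 2 * card V - 5 \<le> card (pairs V - M - F)"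
proof -
  obtain x y where xy: "x \<in> T" "y \<in> T" "\<not> joined F x y"
    using split unfolding joins_all_def by blast
  define S where "S = {z \<in> V. joined F x z}"
  define S' where "S' = V - S"
  have fin: "finite S" "finite S'" "S \<inter> S' = {}" and V_eq: "V = S \<union> S'"
    using V by (auto simp: S_def S'_def)
  have xS: "x \<in> S" and yS': "y \<in> S'" using xy T by (auto simp: S_def S'_def)
  have cV: "card V = card S + card S'"
    unfolding V_eq using fin by (simp add: card_Un_disjoint)
  have notF: "{u, v} \<notin> F" if "u \<in> S" "v \<in> S'" for u v
    using that joined_edge[of u v F] joined_trans[of F x u v] by (auto simp: S_def S'_def)
  let ?D = "pairs V - M - F"
  have "crossing S S' \<subseteq> ?D \<union> (M \<inter> crossing S S')"
    using notF fin V_eq by (auto simp: crossing_def)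
  moreover have finD: "finite ?D" using V finite_pairs by auto
  moreover have fincr: "finite (crossing S S')" using fin by (simp add: crossing_def)
  ultimately have "card (crossing S S') \<le> card (?D \<union> (M \<inter> crossing S S'))"
    by (intro card_mono) auto
  also have "\<dots> \<le> card ?D + card (M \<inter> crossing S S')" by (rule card_Un_le)
  finally have le: "card S * card S' \<le> card ?D + card (M \<inter> crossing S S')"
    using card_crossing fin by metis
  have 1: "card (M \<inter> crossing S S') \<le> card S - 1"
    using M xy xS fin by (intro card_crossing_matching[of _ _ x]) auto
  have 2: "card (M \<inter> crossing S S') \<le> card S' - 1"
    unfolding crossing_commute[of S] using M xy yS' fin by (intro card_crossing_matching[of _ _ y]) auto
  have pos: "1 \<le> card S" "1 \<le> card S'" using fin xS yS' by (auto simp: Suc_le_eq card_gt_0_iff)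
  have le1: "card S * card S' \<le> card ?D + (card S - 1)"
    and le2: "card S * card S' \<le> card ?D + (card S' - 1)" using le 1 2 by linarith+
  show "card V - 1 \<le> card ?D" by (rule cut_arith(1)[OF pos cV le1 le2])
  assume cover: "T \<subseteq> \<Union>F" and six: "6 \<le> card V"
  have two: "\<exists>v\<in>V. v \<noteq> z \<and> {z, v} \<in> F" if z: "z \<in> T" for z
  proof -
    obtain e where e: "e \<in> F" "z \<in> e" using z cover by auto
    then have "e \<in> pairs V" using F by auto
    then show ?thesis using e by (elim pairs_memE[of e V z]) auto
  qed
  obtain v where v: "v \<in> V" "v \<noteq> x" "{x, v} \<in> F" using two xy by blast
  then have "v \<in> S" using joined_edge by (auto simp: S_def)
  then have "card {x, v} \<le> card S" using xS fin by (intro card_mono) auto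
  then have S2: "2 \<le> card S" using v by simp
  obtain w where w: "w \<in> V" "w \<noteq> y" "{y, w} \<in> F" using two xy by blast
  then have "w \<in> S'" using yS' notF[of w y] V_eq by (auto simp: insert_commute)
  then have "card {y, w} \<le> card S'" using yS' fin by (intro card_mono) auto
  then have S'2: "2 \<le> card S'" using w by simp
  show "2 * card V - 5 \<le> card ?D" by (rule cut_arith(2)[OF pos cV le1 le2 S2 S'2 six])
qed

section \<open>Nearly certain edges\<close>

text \<open>
  The vertex \<open>x\<close> of \<open>T\<close> is isolated by the loss of at most $|V| - 2$ edges, fewer than any
  failure of the matching graph needs.
\<close>

lemma missing_terminal_pair_not_optimal:
  assumes V: "finite V" and T: "T \<subseteq> V" "2 \<le> card T"
    and E: "E \<subseteq> pairs V" and M: "M \<subseteq> pairs (V - T)" "disjoint M"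
    and card: "card E = card (pairs V - M)"
    and missing: "{x, z} \<in> pairs V - E" "x \<in> T"
  shows "\<exists>p. 0 < p \<and> p < 1 \<and> bernoulli_mean p E (\<lambda>F. of_bool (joins_all F T))
    < bernoulli_mean p (pairs V - M) (\<lambda>F. of_bool (joins_all F T))"
proof -
  have xz: "x \<in> V" "z \<in> V" "x \<noteq> z" using missing by auto
  have finE: "finite E" "finite (pairs V - M)"
    using finite_pairs[OF V] E finite_subset by auto
  have MT: "T \<inter> \<Union>M = {}" using M by (auto simp: pairs_def)
  have "finite T" using T V finite_subset by blast
  then have "\<not> T \<subseteq> {x}" using T card_mono[of "{x}" T] by auto
  then obtain y where y: "y \<in> T" "y \<noteq> x" by auto
  let ?F = "{e \<in> E. x \<notin> e}"
  have "E - ?F \<subseteq> (\<lambda>v. {x, v}) ` (V - {x, z})"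
  proof
    fix e assume e: "e \<in> E - ?F"
    then have "e \<in> pairs V" "x \<in> e" using E by auto
    then obtain v where "e = {x, v}" "x \<noteq> v" "v \<in> V" by (rule pairs_memE)
    with e missing show "e \<in> (\<lambda>v. {x, v}) ` (V - {x, z})" by auto
  qed
  then have "card (E - ?F) \<le> card ((\<lambda>v. {x, v}) ` (V - {x, z}))"
    using V by (intro card_mono) auto
  also have "\<dots> \<le> card (V - {x, z})" using V by (intro card_image_le) simp
  also have "\<dots> = card V - 2" using xz V by (simp add: card_Diff_subset)
  finally have cut: "card (E - ?F) \<le> card V - 2" .
  have split: "\<not> joins_all ?F T"
    using joins_all_covers[of ?F T x y] missing y by blast
  have "card {x, z} \<le> card V" using xz V by (intro card_mono) auto
  then have n: "Suc (card V - 2) = card V - 1" using xz by simp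
  have "\<exists>p. 0 < p \<and> p < 1 \<and> bernoulli_mean p (pairs V - M) (\<lambda>F. of_bool (\<not> joins_all F T))
    < bernoulli_mean p E (\<lambda>F. of_bool (\<not> joins_all F T))"
  proof (rule smaller_failure_more_likely[where X = ?F])
    fix F assume "F \<subseteq> pairs V - M" "\<not> joins_all F T"
    then show "Suc (card V - 2) \<le> card (pairs V - M - F)"
      unfolding n by (rule matching_complement_cut(1)[OF V T(1) M(2) MT])
  qed (use finE card cut split in auto)
  then show ?thesis using finE by (simp add: bernoulli_mean_of_not)
qed

text \<open>
  Both graphs contain all pairs at targets, so the smallest failures, which isolate a target,
  have the same probability in both and cancel. Among the remaining failures the
  cheapest in \<open>E\<close> cuts off \<open>v\<close> together with the target \<open>r\<close>, at a price of at most
  $(|V| - 2) + (|V| - 4)$ edges.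
\<close>

lemma adjacent_missing_pairs_not_optimal:
  assumes V: "finite V" "6 \<le> card V" and TV: "T \<subseteq> V" and rst: "T = {r, s, t}" "distinct [r, s, t]"
    and E: "E \<subseteq> pairs V" and M: "M \<subseteq> pairs (V - T)" "disjoint M"
    and card: "card E = card (pairs V - M)"
    and terminal_pairs: "{e \<in> pairs V. e \<inter> T \<noteq> {}} \<subseteq> E"
    and missing: "{v, a} \<in> pairs V - E" "{v, b} \<in> pairs V - E" "a \<noteq> b"
  shows "\<exists>p. 0 < p \<and> p < 1 \<and> bernoulli_mean p E (\<lambda>F. of_bool (joins_all F T))
    < bernoulli_mean p (pairs V - M) (\<lambda>F. of_bool (joins_all F T))"
proof -
  let ?K = "{e \<in> pairs V. e \<inter> T \<noteq> {}}"
  have T: "T \<subseteq> V" "r \<in> T" "s \<in> T" "t \<in> T" "T = {r, s, t}" "r \<noteq> s" "r \<noteq> t" "s \<noteq> t"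
    using TV rst by auto
  have finE: "finite E" "finite (pairs V - M)" "finite ?K"
    using finite_pairs[OF V(1)] E finite_subset by auto
  have MT: "T \<inter> \<Union>M = {}" using M by (auto simp: pairs_def)
  have K0: "?K \<subseteq> pairs V - M" using MT by blast
  have vab: "v \<in> V - T" "a \<in> V - T" "b \<in> V - T" "v \<noteq> a" "v \<noteq> b"
  proof -
    have "{v, a} \<inter> T = {}" "{v, b} \<inter> T = {}" using missing terminal_pairs by blast+
    then show "v \<in> V - T" "a \<in> V - T" "b \<in> V - T" "v \<noteq> a" "v \<noteq> b" using missing by auto
  qed
  have covered: "bernoulli_mean p A (\<lambda>F. of_bool (T \<subseteq> \<Union>F))
      = bernoulli_mean p ?K (\<lambda>F. of_bool (T \<subseteq> \<Union>F))"
    if A: "?K \<subseteq> A" "A \<subseteq> pairs V" for p A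
  proof -
    have finA: "finite A" using A finite_pairs[OF V(1)] finite_subset by blast
    have "bernoulli_mean p A (\<lambda>F. of_bool (T \<subseteq> \<Union>F))
        = bernoulli_mean p (?K \<union> (A - ?K)) (\<lambda>F. of_bool (T \<subseteq> \<Union>(F \<inter> ?K)))"
      unfolding bernoulli_mean_def
    proof (rule sum.cong)
      fix F assume "F \<in> Pow (?K \<union> (A - ?K))"
      then have "F \<subseteq> pairs V" using A by auto
      then have "T \<subseteq> \<Union>F \<longleftrightarrow> T \<subseteq> \<Union>(F \<inter> ?K)" by blast
      then show "p ^ card F * (1 - p) ^ card (A - F) * of_bool (T \<subseteq> \<Union>F) =
         p ^ card F * (1 - p) ^ card (?K \<union> (A - ?K) - F) * of_bool (T \<subseteq> \<Union>(F \<inter> ?K))"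
        using A(1) by (simp add: Un_absorb1)
    qed (use A in auto)
    also have "\<dots> = bernoulli_mean p ?K (\<lambda>F. of_bool (T \<subseteq> \<Union>F))"
      using finE(3) finA by (intro bernoulli_mean_disjoint) auto
    finally show ?thesis .
  qed
  let ?P = "\<lambda>F. T \<subseteq> \<Union>F \<and> \<not> joins_all F T"
  \<comment> \<open>The first term is common to both graphs; only failures without an isolated target are left to compare.\<close>
  have reliability: "bernoulli_mean p A (\<lambda>F. of_bool (joins_all F T))
      = bernoulli_mean p ?K (\<lambda>F. of_bool (T \<subseteq> \<Union>F)) - bernoulli_mean p A (\<lambda>F. of_bool (?P F))"
    if "?K \<subseteq> A" "A \<subseteq> pairs V" for p A
  proof -
    have "(of_bool (joins_all F T) :: real) = of_bool (T \<subseteq> \<Union>F) - of_bool (?P F)" for F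
      using joins_all_covers[of F T r s] T by (auto simp: of_bool_def)
    then show ?thesis
      using covered[OF that] by (simp add: bernoulli_mean_diff)
  qed
  \<comment> \<open>All edges that do not leave the set of \<open>r\<close> and \<open>v\<close>.\<close>
  let ?F = "{e \<in> E. r \<in> e \<longleftrightarrow> v \<in> e}"
  have rv: "r \<noteq> v" "r \<in> V" using vab T by auto
  have "E - ?F \<subseteq> (\<lambda>u. {r, u}) ` (V - {r, v}) \<union> (\<lambda>u. {v, u}) ` (V - {r, v, a, b})"
  proof
    fix e assume e: "e \<in> E - ?F"
    then have ep: "e \<in> pairs V" using E by auto
    show "e \<in> (\<lambda>u. {r, u}) ` (V - {r, v}) \<union> (\<lambda>u. {v, u}) ` (V - {r, v, a, b})"
    proof (cases "r \<in> e")
      case True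
      with ep obtain u where "e = {r, u}" "r \<noteq> u" "u \<in> V" by (rule pairs_memE)
      with e show ?thesis by auto
    next
      case False
      then have "v \<in> e" using e by auto
      with ep obtain u where "e = {v, u}" "v \<noteq> u" "u \<in> V" by (rule pairs_memE)
      with e False missing show ?thesis by auto
    qed
  qed
  then have "card (E - ?F)
      \<le> card ((\<lambda>u. {r, u}) ` (V - {r, v}) \<union> (\<lambda>u. {v, u}) ` (V - {r, v, a, b}))"
    using V by (intro card_mono) auto
  also have "\<dots> \<le> card ((\<lambda>u. {r, u}) ` (V - {r, v})) + card ((\<lambda>u. {v, u}) ` (V - {r, v, a, b}))"
    by (rule card_Un_le)
  also have "\<dots> \<le> card (V - {r, v}) + card (V - {r, v, a, b})"
    using V by (intro add_mono card_image_le) auto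
  also have "\<dots> = (card V - 2) + (card V - 4)"
  proof -
    have "card {r, v, a, b} = 4" "{r, v, a, b} \<subseteq> V" using vab T missing(3) by auto
    moreover have "card {r, v} = 2" "{r, v} \<subseteq> V" using rv vab by auto
    ultimately show ?thesis by (metis card_Diff_subset finite.emptyI finite.insertI)
  qed
  finally have cut: "card (E - ?F) \<le> 2 * card V - 6" using V by linarith
  have "\<not> joined ?F r s"
  proof
    assume "joined ?F r s"
    then have "s \<in> {r, v}" by (rule joined_closed) (use rv in auto)
    then show False using T vab by auto
  qed
  then have "\<not> joins_all ?F T" using T(2,3) unfolding joins_all_def by meson
  moreover have "T \<subseteq> \<Union>?F"
  proof -
    have "{r, v} \<in> E" using terminal_pairs T(1,2) vab(1) rv by (intro subsetD[OF terminal_pairs]) auto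
    moreover have "{s, t} \<in> E" using T(1,3,4,8) by (intro subsetD[OF terminal_pairs]) auto
    ultimately have "{r, v} \<in> ?F" "{s, t} \<in> ?F" using T(2-7) vab(1) by auto
    then show ?thesis unfolding T(5) by (meson UnionI empty_subsetI insertI1 insertI2 insert_subset)
  qed
  ultimately have split: "?P ?F" by blast
  have n: "Suc (2 * card V - 6) = 2 * card V - 5" using V by linarith
  have "\<exists>p. 0 < p \<and> p < 1 \<and> bernoulli_mean p (pairs V - M) (\<lambda>F. of_bool (?P F))
    < bernoulli_mean p E (\<lambda>F. of_bool (?P F))"
  proof (rule smaller_failure_more_likely[where X = ?F])
    fix F assume "F \<subseteq> pairs V - M" "?P F"
    then show "Suc (2 * card V - 6) \<le> card (pairs V - M - F)"
      unfolding n using matching_complement_cut(2)[OF V(1) T(1) M(2) MT, of F] V(2) by blast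
  qed (use finE card cut split in auto)
  then show ?thesis
    using reliability[OF terminal_pairs E] reliability[OF K0] by auto
qed

section \<open>Rarely surviving edges\<close>

text \<open>
  If both extra edges are needed, then neither of them is pendant, so \<open>F\<close> covers
  \<open>a\<close>, \<open>b\<close>, \<open>c\<close>, \<open>d\<close> besides the three targets. Seven vertices require four edges.
\<close>

lemma both_extra_edges_needed:
  assumes F: "finite F" "F \<subseteq> pairs V" and T: "finite T" "card T = 3"
    and abcd: "distinct [a, b, c, d]" "{a, b, c, d} \<inter> T = {}"
    and both: "joins_all (insert {a, c} (insert {b, d} F)) T"
    and one: "\<not> joins_all (insert {a, c} F) T" "\<not> joins_all (insert {b, d} F) T"
  shows "4 \<le> card F"
proof -
  have "a \<in> \<Union>(insert {b, d} F)"
    using joins_all_pendant[of a c "insert {b, d} F"] both one abcd by auto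
  moreover have "c \<in> \<Union>(insert {b, d} F)"
    using joins_all_pendant[of c a "insert {b, d} F"] both one abcd
    by (auto simp: insert_commute)
  moreover have "b \<in> \<Union>(insert {a, c} F)"
    using joins_all_pendant[of b d "insert {a, c} F"] both one abcd
    by (auto simp: insert_commute)
  moreover have "d \<in> \<Union>(insert {a, c} F)"
    using joins_all_pendant[of d b "insert {a, c} F"] both one abcd
    by (auto simp: insert_commute)
  ultimately have abcd_F: "{a, b, c, d} \<subseteq> \<Union>F" using abcd by auto
  obtain x y where "x \<in> T" "y \<in> T" "x \<noteq> y"
    using T by (auto simp: card_3_iff)
  from joins_all_covers[OF both this] have "T \<subseteq> \<Union>F" using abcd by auto
  with abcd_F have "card ({a, b, c, d} \<union> T) \<le> 2 * card F"
    using F by (intro card_covered_le) auto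
  moreover have "card ({a, b, c, d} \<union> T) = 7"
    using T abcd by (subst card_Un_disjoint) auto
  ultimately show ?thesis by simp
qed

text \<open>
  As above, \<open>F\<close> covers \<open>b\<close>, \<open>c\<close>, \<open>d\<close> and the targets, six vertices, which only yields three
  edges. To gain one, remove an edge \<open>g\<close> at \<open>b\<close>; the rest still covers five
  vertices. Indeed, if it covers \<open>b\<close>, then it covers all six vertices but at most the other end of \<open>g\<close>.
  Otherwise \<open>g\<close> is pendant even after \<open>cd\<close> has been added, so \<open>F\<close> without \<open>g\<close> satisfies the
  same assumptions about \<open>cd\<close> as \<open>F\<close>, and covers \<open>c\<close>, \<open>d\<close> and the targets.
\<close>

lemma adjacent_extra_edges_each_suffice:
  assumes F: "finite F" "F \<subseteq> pairs V" and T: "finite T" "card T = 3"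
    and bcd: "distinct [b, c, d]" "{b, c, d} \<inter> T = {}"
    and each: "joins_all (insert {c, d} F) T" "joins_all (insert {b, d} F) T"
    and split: "\<not> joins_all F T"
  shows "4 \<le> card F"
proof -
  obtain x y where xy: "x \<in> T" "y \<in> T" "x \<noteq> y"
    using T by (auto simp: card_3_iff)
  have ends: "{c, d} \<union> T \<subseteq> \<Union>F'"
    if "joins_all (insert {c, d} F') T" "\<not> joins_all F' T" for F'
  proof -
    have "c \<in> \<Union>F'" using joins_all_pendant[of c d F'] that bcd by auto
    moreover have "d \<in> \<Union>F'" using joins_all_pendant[of d c F'] that bcd by (auto simp: insert_commute)
    ultimately show ?thesis using joins_all_covers[OF that(1) xy] by auto
  qed
  have cdT: "{c, d} \<union> T \<subseteq> \<Union>F" using ends each split by blast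
  have "b \<in> \<Union>F" using joins_all_pendant[of b d F] each split bcd by auto
  then obtain g where g: "g \<in> F" "b \<in> g" by blast
  then obtain z where z: "g = {b, z}" "b \<noteq> z" using F by (meson pairs_memE subsetD)
  let ?F' = "F - {g}"
  have card5: "card ({c, d} \<union> T) = 5" using T bcd by (subst card_Un_disjoint) auto
  have "\<exists>C. C \<subseteq> \<Union>?F' \<and> card C = 5"
  proof (cases "b \<in> \<Union>?F'")
    case True
    let ?C = "insert b ({c, d} \<union> T)"
    have "?C - {z} \<subseteq> \<Union>?F'"
    proof
      fix x assume x: "x \<in> ?C - {z}"
      show "x \<in> \<Union>?F'"
      proof (cases "x = b")
        case True
        with \<open>b \<in> \<Union>?F'\<close> show ?thesis by simp
      next
        case False
        then obtain e where "e \<in> F" "x \<in> e" using x cdT by blast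
        moreover have "e \<noteq> g" using x False z \<open>x \<in> e\<close> by auto
        ultimately show ?thesis by blast
      qed
    qed
    moreover have "card ?C = 6" using card5 bcd T by simp
    then have "5 \<le> card (?C - {z})" using T by (simp add: card_Diff_singleton_if)
    ultimately show ?thesis by (meson obtain_subset_with_card_n order_trans)
  next
    case False
    have "insert {c, d} F = insert {b, z} (insert {c, d} ?F')" using g z by auto
    then have "joins_all (insert {c, d} ?F') T"
      using joins_all_pendant[of b z "insert {c, d} ?F'"] each False bcd by auto
    moreover have "\<not> joins_all ?F' T" using split joins_all_mono[of ?F' F] by blast
    ultimately show ?thesis
      by (intro exI[of _ "{c, d} \<union> T"] conjI ends card5)
  qed
  then obtain C where C: "C \<subseteq> \<Union>?F'" "card C = 5" by blast
  have "card C \<le> 2 * card ?F'" using F C by (intro card_covered_le) auto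
  then show ?thesis using C g F by (simp add: card_Diff_singleton_if)
qed

text \<open>
  The gain of \<open>cd\<close> over \<open>ac\<close> in the presence of \<open>bd\<close> is compared with the gain in its absence,
  whose mean vanishes by symmetry. With at most three edges in \<open>F\<close>, the former is at least the
  latter, because by the two preceding lemmas \<open>ac\<close> and \<open>bd\<close> are never both needed, and \<open>cd\<close> and
  \<open>bd\<close> suffice each only if \<open>F\<close> joins the targets by itself. The particular \<open>F\<close> singled out in
  the statement needs both \<open>bd\<close> and \<open>cd\<close> and makes the inequality strict on average. With four
  or more edges nothing is claimed: the correction makes the bound trivial.
\<close>

lemma adjacent_extra_edges_gain:
  fixes J :: "'a set set \<Rightarrow> real"
  assumes F: "finite F" "F \<subseteq> pairs V" and T: "T = {r, s, t}" "distinct [r, s, t]"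
    and abcd: "distinct [a, b, c, d]" "{a, b, c, d} \<inter> T = {}"
  defines "J \<equiv> \<lambda>F. of_bool (joins_all F T)"
  shows "J (insert {c, d} F) - J (insert {a, c} F)
      + of_bool (F = {{r, b}, {s, d}, {t, c}}) - of_bool (4 \<le> card F)
    \<le> J (insert {c, d} (insert {b, d} F)) - J (insert {a, c} (insert {b, d} F))"
proof -
  have T': "finite T" "card T = 3" using T by auto
  have up: "joins_all (insert {c, d} F) T \<Longrightarrow> joins_all (insert {c, d} (insert {b, d} F)) T"
    "joins_all (insert {b, d} F) T \<Longrightarrow> joins_all (insert {c, d} (insert {b, d} F)) T"
    "joins_all F T \<Longrightarrow> joins_all (insert {a, c} F) T"
    by (erule joins_all_mono[rotated], blast)+
  let ?F0 = "{{r, b}, {s, d}, {t, c}}"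
  show ?thesis
  proof (cases "F = ?F0")
    case True
    have card: "card F = 3" using True T abcd by (auto simp: doubleton_eq_iff)
    have "\<not> joins_all (insert {c, d} F) T"
    proof
      assume "joins_all (insert {c, d} F) T"
      moreover have "insert {c, d} F = insert {b, r} {{c, d}, {s, d}, {t, c}}"
        using True by auto
      ultimately have "joins_all {{c, d}, {s, d}, {t, c}} T"
        using joins_all_pendant[of b r "{{c, d}, {s, d}, {t, c}}" T] T abcd by auto
      from joins_all_covers[OF this, of r s] show False using T abcd by auto
    qed
    moreover have "\<not> joins_all (insert {b, d} F) T"
    proof
      assume "joins_all (insert {b, d} F) T"
      moreover have "insert {b, d} F = insert {c, t} {{b, d}, {s, d}, {r, b}}"
        using True by auto
      ultimately have "joins_all {{b, d}, {s, d}, {r, b}} T"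
        using joins_all_pendant[of c t "{{b, d}, {s, d}, {r, b}}" T] T abcd by auto
      from joins_all_covers[OF this, of r s] show False using T abcd by auto
    qed
    moreover have "joins_all (insert {a, c} (insert {b, d} F)) T \<Longrightarrow> joins_all (insert {a, c} F) T"
      using both_extra_edges_needed[OF F T' abcd] card calculation by auto
    moreover have "joins_all (insert {c, d} (insert {b, d} F)) T"
    proof -
      let ?G = "insert {c, d} (insert {b, d} F)"
      have e: "joined ?G d b" "joined ?G b r" "joined ?G d s" "joined ?G d c" "joined ?G c t"
        using True by (intro joined_edge; auto simp: insert_commute)+
      then have "joined ?G d x" if "x \<in> T" for x
        using that T joined_trans by (metis empty_iff insert_iff)
      then show ?thesis unfolding joins_all_def by (meson joined_sym joined_trans)
    qed
    ultimately show ?thesis using card unfolding J_def by (auto simp: of_bool_def)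
  next
    case False
    have "4 \<le> card F" if "joins_all (insert {a, c} (insert {b, d} F)) T"
        "\<not> joins_all (insert {a, c} F) T"
        "joins_all (insert {c, d} F) T \<or> \<not> joins_all (insert {b, d} F) T"
    proof (cases "joins_all (insert {b, d} F) T")
      case True
      then show ?thesis
        using that up adjacent_extra_edges_each_suffice[OF F T', of b c d] abcd by auto
    next
      case False
      then show ?thesis using that both_extra_edges_needed[OF F T' abcd] by blast
    qed
    with False up show ?thesis unfolding J_def by (auto simp: of_bool_def)
  qed
qed

text \<open>
  The assumption \<open>twins\<close> makes the transposition of \<open>a\<close> and \<open>d\<close> a symmetry of \<open>E\<close> without
  \<open>ac\<close> and \<open>bd\<close>. The leading term of the difference of the two means is therefore the
  probability, of order $p^3$, of the three edges \<open>rb\<close>, \<open>sd\<close>, \<open>tc\<close>, up to the factor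
  $p^2$ for the two extra edges; the error is of order $p^4$.
\<close>

lemma matching_beaten_by_path:
  assumes V: "finite V" and T: "T = {r, s, t}" "distinct [r, s, t]"
    and E: "E \<subseteq> pairs V"
    and abcd: "distinct [a, b, c, d]" "{a, b, c, d} \<inter> T = {}"
    and in_E: "{a, c} \<in> E" "{b, d} \<in> E" "{r, b} \<in> E" "{s, d} \<in> E" "{t, c} \<in> E"
    and notin_E: "{a, b} \<notin> E" "{c, d} \<notin> E"
    and twins: "\<And>v. v \<notin> {a, b, c, d} \<Longrightarrow> {a, v} \<in> E \<longleftrightarrow> {d, v} \<in> E"
  shows "\<exists>p. 0 < p \<and> p < 1 \<and> bernoulli_mean p E (\<lambda>F. of_bool (joins_all F T))
    < bernoulli_mean p (insert {c, d} (E - {{a, c}})) (\<lambda>F. of_bool (joins_all F T))"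
proof -
  define B where "B = E - {{a, c}, {b, d}}"
  define J where "J F = (of_bool (joins_all F T) :: real)" for F
  let ?F0 = "{{r, b}, {s, d}, {t, c}}"
  let ?\<tau> = "Transposition.transpose a d"
  have finB: "finite B" and BV: "B \<subseteq> pairs V"
    using E finite_pairs[OF V] finite_subset by (auto simp: B_def)
  have neq: "{a, c} \<noteq> {b, d}" "{c, d} \<noteq> {b, d}" using abcd by (auto simp: doubleton_eq_iff)
  have notin: "{a, c} \<notin> insert {b, d} B" "{c, d} \<notin> insert {b, d} B" "{b, d} \<notin> B"
    using neq notin_E by (auto simp: B_def)
  have E_eq: "E = insert {a, c} (insert {b, d} B)"
    and H_eq: "insert {c, d} (E - {{a, c}}) = insert {c, d} (insert {b, d} B)"
    using in_E neq by (auto simp: B_def)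
  have F0: "?F0 \<subseteq> B" "card ?F0 = 3"
    using in_E abcd T by (auto simp: B_def doubleton_eq_iff)
  have \<tau>T: "?\<tau> x = x" if "x \<in> T" for x
    using that abcd by (auto simp: Transposition.transpose_def)
  have \<tau>_sub: "(`) ?\<tau> ` B \<subseteq> B"
  proof
    fix e' assume "e' \<in> (`) ?\<tau> ` B"
    then obtain e where e: "e \<in> B" "e' = ?\<tau> ` e" by auto
    then have ep: "e \<in> pairs V" "e \<in> E" using BV by (auto simp: B_def)
    have moved: "{x', v} \<in> B" if "{x, v} \<in> B" "(x, x') \<in> {(a, d), (d, a)}" "v \<notin> {a, d}" for x x' v
    proof -
      have "v \<notin> {a, b, c, d}" using that notin_E by (auto simp: B_def insert_commute)
      then show ?thesis using that twins[of v] by (auto simp: B_def doubleton_eq_iff)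
    qed
    consider "a \<in> e" "d \<in> e" | "a \<notin> e" "d \<notin> e" | "a \<in> e" "d \<notin> e" | "a \<notin> e" "d \<in> e" by blast
    then show "e' \<in> B"
    proof cases
      case 1
      then have "e = {a, d}" using ep abcd by (elim pairs_memE[of e V a]) auto
      then show ?thesis using e by (simp add: insert_commute)
    next
      case 2
      then have "?\<tau> ` e = id ` e" by (intro image_cong) (auto simp: Transposition.transpose_def)
      then show ?thesis using e by simp
    next
      case 3
      obtain v where v: "e = {a, v}" "a \<noteq> v" using ep(1) 3(1) by (rule pairs_memE)
      then have "v \<notin> {a, d}" using 3 by auto
      with v e show ?thesis using moved[of a v d] by simp
    next
      case 4
      obtain v where v: "e = {d, v}" "d \<noteq> v" using ep(1) 4(2) by (rule pairs_memE)
      then have "v \<notin> {a, d}" using 4 by auto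
      with v e show ?thesis using moved[of d v a] by simp
    qed
  qed
  have \<tau>\<tau>: "(`) ?\<tau> ` (`) ?\<tau> ` F = F" for F :: "'a set set"
    by (simp add: image_image)
  have \<tau>B: "(`) ?\<tau> ` B = B"
    using \<tau>_sub image_mono[OF \<tau>_sub, of "(`) ?\<tau>"] \<tau>\<tau>[of B] by auto
  \<comment> \<open>The transposition is an involution that fixes the targets, so it preserves whether they are joined.\<close>
  have J\<tau>: "J ((`) ?\<tau> ` F) = J F" for F
    using joins_all_image[of F T ?\<tau>] joins_all_image[of "(`) ?\<tau> ` F" T ?\<tau>] \<tau>T \<tau>\<tau>[of F]
    by (auto simp: J_def)
  have ac_d: "?\<tau> ` {a, c} = {c, d}" using abcd by (auto simp: Transposition.transpose_def)
  have "inj_on ((`) ?\<tau>) (Pow UNIV)" by (intro inj_on_image_Pow inj_transpose)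
  then have "inj_on ((`) ?\<tau>) B" by (rule inj_on_subset) simp
  moreover have "J (insert {c, d} ((`) ?\<tau> ` F)) = J (insert {a, c} F)" for F
    using J\<tau>[of "insert {a, c} F"] by (simp only: image_insert[of "(`) ?\<tau>"] ac_d)
  ultimately have swap: "bernoulli_mean p B (\<lambda>F. J (insert {c, d} F))
      = bernoulli_mean p B (\<lambda>F. J (insert {a, c} F))" for p
    using bernoulli_mean_image[of "(`) ?\<tau>" B p "\<lambda>F. J (insert {c, d} F)"] 
    by (simp add: \<tau>B)
  obtain p :: real where p: "0 < p" "p < 1"
      and dom: "2 ^ card B * p ^ Suc 3 < p ^ 3 * (1 - p) ^ card (B - ?F0)"
    using exists_dominating_probability[of "2 ^ card B" 3 "card (B - ?F0)"] by auto
  let ?L = "\<lambda>F :: 'a set set. of_bool (4 \<le> card F) :: real"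
  let ?X = "\<lambda>F. J (insert {c, d} (insert {b, d} F))"
  let ?Y = "\<lambda>F. J (insert {a, c} (insert {b, d} F))"
  have "bernoulli_mean p B ?L \<le> 2 ^ card B * p ^ Suc 3"
  proof (rule bernoulli_mean_event_le)
    fix F :: "'a set set" assume "4 \<le> card F"
    then have "p ^ card F \<le> p ^ Suc 3" using p by (intro power_decreasing) auto
    moreover have "(1 - p) ^ card (B - F) \<le> 1" using p by (intro power_le_one) auto
    ultimately show "p ^ card F * (1 - p) ^ card (B - F) \<le> p ^ Suc 3"
      using mult_mono[of "p ^ card F" "p ^ Suc 3" "(1 - p) ^ card (B - F)" 1] p by simp
  qed (use finB p in auto)
  also have "\<dots> < bernoulli_mean p B (\<lambda>F. of_bool (F = ?F0))"
    using dom bernoulli_mean_single[OF finB F0(1)] F0(2) by simp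
  finally have rare: "bernoulli_mean p B ?L < bernoulli_mean p B (\<lambda>F. of_bool (F = ?F0))" .
  have "bernoulli_mean p B (\<lambda>F. J (insert {c, d} F) - J (insert {a, c} F)
        + of_bool (F = ?F0) - ?L F) \<le> bernoulli_mean p B (\<lambda>F. ?X F - ?Y F)"
  proof (rule bernoulli_mean_mono)
    fix F assume "F \<subseteq> B"
    then have "finite F" "F \<subseteq> pairs V" using finB BV finite_subset by auto
    then show "J (insert {c, d} F) - J (insert {a, c} F) + of_bool (F = ?F0) - ?L F \<le> ?X F - ?Y F"
      unfolding J_def by (rule adjacent_extra_edges_gain[OF _ _ T abcd])
  qed (use p in auto)
  then have XY: "bernoulli_mean p B ?Y < bernoulli_mean p B ?X"
    using swap rare by (simp add: bernoulli_mean_diff bernoulli_mean_add)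
  \<comment> \<open>Conditioning on the two extra edges: the terms with at most one of them agree for \<open>ac\<close> and \<open>cd\<close>.\<close>
  have expand: "bernoulli_mean p (insert e (insert {b, d} B)) J =
      p * (p * bernoulli_mean p B (\<lambda>F. J (insert e (insert {b, d} F)))
        + (1 - p) * bernoulli_mean p B (\<lambda>F. J (insert e F)))
      + (1 - p) * bernoulli_mean p (insert {b, d} B) J"
    if "e \<notin> insert {b, d} B" for e
    using that finB notin(3)
    by (simp add: bernoulli_mean_insert[of "insert {b, d} B" e]
        bernoulli_mean_insert[of B "{b, d}" p "\<lambda>F. J (insert e F)"])
  have "bernoulli_mean p E J < bernoulli_mean p (insert {c, d} (E - {{a, c}})) J"
    unfolding E_eq H_eq[unfolded E_eq] expand[OF notin(1)] expand[OF notin(2)] swap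
    using XY p by simp
  then show ?thesis using p unfolding J_def by blast
qed

section \<open>Incompatibility of the two optima\<close>

theorem theorem3p3:
  fixes n l m :: nat
  assumes "7 \<le> n"
    and "2 \<le> l"
    and "l \<le> (n - 3) div 2"
    and "m = (n choose 2) - l"
  shows "\<not> (\<exists>G :: 'a three_terminal_graph. uniformly_most_reliable n m G)"
proof
  assume "\<exists>G :: 'a three_terminal_graph. uniformly_most_reliable n m G"
  then obtain G :: "'a three_terminal_graph"
    where G: "G \<in> three_terminal_graphs n m"
      and best: "\<And>(H :: 'a three_terminal_graph) p. H \<in> three_terminal_graphs n m \<Longrightarrow> p \<in> {0..1} \<Longrightarrow> reliability3 H p \<le> reliability3 G p"
    unfolding uniformly_most_reliable_def by blast
  define V where "V = verts G"
  define E where "E = edges G"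
  define r where "r = term_r G"
  define s where "s = term_s G"
  define t where "t = term_t G"
  define T where "T = {r, s, t}"
  have simple: "simple_three_terminal_graph G" and cV: "card V = n" and cE: "card E = m"
    using G by (auto simp: three_terminal_graphs_def V_def E_def)
  have V: "finite V" and E: "E \<subseteq> pairs V" and TV: "T \<subseteq> V"
    and dist: "r \<noteq> s" "r \<noteq> t" "s \<noteq> t"
    using simple
    by (auto simp: simple_three_terminal_graph_def V_def E_def T_def r_def s_def t_def pairs_def)
  have T3: "finite T" "card T = 3" using dist by (auto simp: T_def)
  have optimal: "\<not> (\<exists>p. 0 < p \<and> p < 1 \<and> bernoulli_mean p E (\<lambda>F. of_bool (joins_all F T))
      < bernoulli_mean p A (\<lambda>F. of_bool (joins_all F T)))"
    if A: "A \<subseteq> pairs V" "card A = m" for A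
  proof
    assume "\<exists>p. 0 < p \<and> p < 1 \<and> bernoulli_mean p E (\<lambda>F. of_bool (joins_all F T))
      < bernoulli_mean p A (\<lambda>F. of_bool (joins_all F T))"
    then obtain p where p: "0 < p" "p < 1" and less: "bernoulli_mean p E (\<lambda>F. of_bool (joins_all F T))
      < bernoulli_mean p A (\<lambda>F. of_bool (joins_all F T))" by blast
    let ?H = "G\<lparr>edges := A\<rparr>"
    have H: "simple_three_terminal_graph ?H"
      using simple A by (auto simp: simple_three_terminal_graph_def V_def pairs_def)
    then have "?H \<in> three_terminal_graphs n m"
      using A cV by (auto simp: three_terminal_graphs_def V_def)
    then have "reliability3 ?H p \<le> reliability3 G p" using best p by simp
    with less show False
      using reliability3_eq_bernoulli_mean[OF H, of p] reliability3_eq_bernoulli_mean[OF simple, of p] p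
      by (simp add: E_def T_def r_def s_def t_def)
  qed
  have cW: "card (V - T) = n - 3" using T3 TV V cV by (simp add: card_Diff_subset)
  have "2 * l \<le> card (V - T)" using assms(3) cW by linarith
  then obtain M where M: "M \<subseteq> pairs (V - T)" "card M = l" "disjoint M"
    using disjoint_pairs_exist[of "V - T" l] V by auto
  have MV: "M \<subseteq> pairs V" using M by (auto simp: pairs_def)
  have "card (pairs V - M) = card (pairs V) - card M"
    using MV finite_pairs[OF V] finite_subset by (intro card_Diff_subset) auto
  then have cM: "card (pairs V - M) = m" using M assms(4) card_pairs[OF V] cV by simp
  have opt_M: "\<not> (\<exists>p. 0 < p \<and> p < 1 \<and> bernoulli_mean p E (\<lambda>F. of_bool (joins_all F T))
      < bernoulli_mean p (pairs V - M) (\<lambda>F. of_bool (joins_all F T)))"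
    using optimal[of "pairs V - M"] cM by auto
  have terminal_pairs: "{x, z} \<in> E" if "x \<in> T" "z \<in> V" "x \<noteq> z" for x z
    using missing_terminal_pair_not_optimal[OF V TV _ E M(1,3), of x z] opt_M that TV T3 cE cM by auto
  have terminal_pairs': "{e \<in> pairs V. e \<inter> T \<noteq> {}} \<subseteq> E"
  proof
    fix e assume "e \<in> {e \<in> pairs V. e \<inter> T \<noteq> {}}"
    then obtain x where x: "e \<in> pairs V" "x \<in> e" "x \<in> T" by auto
    from x(1,2) obtain z where "e = {x, z}" "x \<noteq> z" "z \<in> V" by (rule pairs_memE)
    then show "e \<in> E" using terminal_pairs x by simp
  qed
  have matching: "x = y" if "{v, x} \<in> pairs V - E" "{v, y} \<in> pairs V - E" for v x y
  proof (rule ccontr)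
    assume "x \<noteq> y"
    with adjacent_missing_pairs_not_optimal[OF V _ TV T_def _ E M(1,3) _ terminal_pairs' that]
    show False using opt_M cV assms(1) cE cM dist by simp
  qed
  let ?N = "pairs V - E"
  have finN: "finite ?N" using finite_pairs[OF V] by simp
  have "card ?N = card (pairs V) - card E"
    using E finite_pairs[OF V] finite_subset by (intro card_Diff_subset) auto
  moreover have "l \<le> n choose 2"
    using card_mono[OF finite_pairs[OF V] MV] M card_pairs[OF V] cV by simp
  ultimately have "2 \<le> card ?N" using cE assms cV card_pairs[OF V] by simp
  then obtain N where "N \<subseteq> ?N" "card N = 2" by (meson obtain_subset_with_card_n)
  then obtain e e' where e: "e \<in> ?N" "e' \<in> ?N" "e \<noteq> e'"
    by (auto simp: card_2_iff)
  obtain a b where ab: "e = {a, b}" "a \<noteq> b" using e by (auto simp: pairs_def card_2_iff)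
  obtain c d where cd: "e' = {c, d}" "c \<noteq> d" using e by (auto simp: pairs_def card_2_iff)
  have disj: "e \<inter> e' = {}"
  proof (rule ccontr)
    assume "e \<inter> e' \<noteq> {}"
    then obtain v where v: "v \<in> e" "v \<in> e'" by blast
    obtain x where x: "e = {v, x}" using e(1) v(1) pairs_memE by (metis DiffD1)
    obtain y where y: "e' = {v, y}" using e(2) v(2) pairs_memE by (metis DiffD1)
    show False using matching[of v x y] e x y by simp
  qed
  have "a \<noteq> c" "a \<noteq> d" "b \<noteq> c" "b \<noteq> d"
    using disj ab cd by auto
  then have abcd: "distinct [a, b, c, d]" using ab cd by simp
  have inV: "a \<in> V" "b \<in> V" "c \<in> V" "d \<in> V" using e ab cd by auto
  have notT: "{a, b, c, d} \<inter> T = {}"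
  proof -
    have "e \<inter> T = {}" "e' \<inter> T = {}" using e terminal_pairs' by blast+
    then show ?thesis using ab cd by auto
  qed
  have partner: "{x, v} \<in> E" if "{x, y} \<in> ?N" "v \<in> V" "v \<noteq> x" "v \<noteq> y" for x y v
  proof (rule ccontr)
    assume "{x, v} \<notin> E"
    then have "{x, v} \<in> ?N" using that(1-3) by simp
    from matching[OF this that(1)] that(4) show False by simp
  qed
  have missing: "{a, b} \<in> ?N" "{b, a} \<in> ?N" "{d, c} \<in> ?N"
    using e ab cd by (simp_all add: insert_commute)
  have rst: "r \<in> T" "s \<in> T" "t \<in> T" by (auto simp: T_def)
  have twins: "{a, v} \<in> E \<longleftrightarrow> {d, v} \<in> E" if "v \<notin> {a, b, c, d}" for v
  proof (cases "v \<in> V")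
    case True
    then have "{a, v} \<in> E" "{d, v} \<in> E"
      using that by (intro partner[OF missing(1)] partner[OF missing(3)]; simp)+
    then show ?thesis by simp
  next
    case False
    then have "{a, v} \<notin> pairs V" "{d, v} \<notin> pairs V" by simp_all
    then show ?thesis using E by blast
  qed
  have in_E: "{a, c} \<in> E" "{b, d} \<in> E" "{r, b} \<in> E" "{s, d} \<in> E" "{t, c} \<in> E"
    using partner[OF missing(1), of c] partner[OF missing(2), of d] inV abcd
      terminal_pairs[OF rst(1) inV(2)] terminal_pairs[OF rst(2) inV(4)] terminal_pairs[OF rst(3) inV(3)]
      notT rst by auto
  have beaten: "\<exists>p. 0 < p \<and> p < 1 \<and> bernoulli_mean p E (\<lambda>F. of_bool (joins_all F T))
    < bernoulli_mean p (insert {c, d} (E - {{a, c}})) (\<lambda>F. of_bool (joins_all F T))"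
  proof (rule matching_beaten_by_path[OF V T_def _ E abcd notT in_E _ _ twins])
    show "distinct [r, s, t]" using dist by simp
    show "{a, b} \<notin> E" "{c, d} \<notin> E" using e ab cd by auto
  qed
  have finE: "finite E" using E finite_pairs[OF V] finite_subset by blast
  have "card (insert {c, d} (E - {{a, c}})) = m"
    using e cd in_E finE cE card_Suc_Diff1[OF finE in_E(1)] by simp
  then show False using optimal[of "insert {c, d} (E - {{a, c}})"] beaten E e cd by blast
qed

end
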